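(* Let $\eta\geq 3$ and $k\geq 1$ be integers, and let $\zeta_\eta:\{\xi\in\mathbb{Z}:\gcd(\xi,\eta)=1\}\to\{0,1\}$ be a function such that $\zeta_\eta(\theta_1)=\zeta_\eta(\theta_2)$ whenever $\gcd(\theta_1,\eta)=\gcd(\theta_2,\eta)=1$ and $\theta_1\equiv\theta_2\pmod{\eta}$. For $j=0,1$ let $A_j=\{a\in\mathbb{Z}:0<a<\eta,\ \gcd(a,\eta)=1,\ \zeta_\eta(a)=j\}$. Let $G$ be a graph of order $n$ and $H$ a graph of order $k\eta$, and let $g:V(G)\to\{1,2,\ldots,n\}$ and $h:V(H)\to\{1,2,\ldots,k\eta\}$ be bijections. Define $$\Gamma_1^G=\{uv\in E(G):\gcd(g(u)+g(v),\eta)=1\text{ and }\zeta_\eta(g(u)+g(v))=1\},$$ $$\Gamma_0^G=\{uv\in E(G):\gcd(g(u)+g(v),\eta)\neq 1\}\cup\{uv\in E(G):\gcd(g(u)+g(v),\eta)=1\text{ and }\zeta_\eta(g(u)+g(v))=0\},$$ $$\Gamma_1^H=\{uv\in E(H):\gcd(h(u)+h(v),\eta)=1\text{ and }\zeta_\eta(h(u)+h(v))=1\},$$ $$\Gamma_0^H=\{uv\in E(H):\gcd(h(u)+h(v),\eta)\neq 1\}\cup\{uv\in E(H):\gcd(h(u)+h(v),\eta)=1\text{ and }\zeta_\eta(h(u)+h(v))=0\},$$ and $$\varpi(G\circ H;g,h)=nk[\eta-\phi(\eta)+|A_0|-|A_1|]+n[|\Gamma_0^H|-|\Gamma_1^H|]+|\Gamma_0^G|-|\Gamma_1^G|,$$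 where $\phi$ is Euler's phi function. If $|\varpi(G\circ H;g,h)|\leq 1$, then the corona graph $G\circ H$ is an arithmetic cordial graph modulo $\eta$ under $\langle S,\zeta_\eta,+\rangle$, where $S=\{1,2,\ldots,n(k\eta+1)\}$. In addition, if $\varpi(G\circ H;g,h)$ equals $0$, $1$, or $-1$, then $G\circ H$ is, respectively, a perfect, positive, or negative arithmetic cordial graph modulo $\eta$ under $\langle S,\zeta_\eta,+\rangle$.
   Context: All graphs are finite and simple, not necessarily connected; the order of a graph is its number of vertices. Arithmetic cordial labeling: let $\eta$ be a positive integer, $G$ a graph with $n$ vertices, $S\subset\mathbb{Z}$ with $|S|=n$, $\star:S\times S\to\mathbb{Z}$ a binary function, and $\zeta_\eta:\{\xi\in\mathbb{Z}:\gcd(\xi,\eta)=1\}\to\{0,1\}$ a function. A bijection $f:V(G)\to S$ is an arithmetic cordial labeling modulo $\eta$ under $\langle S,\zeta_\eta,\star\rangle$ if the induced edge labeling $f_\eta^*:E(G)\to\{0,1\}$, given by $f_\eta^*(uv)=1$ if $\gcd(f(u)\star f(v),\eta)=1$ and $\zeta_\eta(f(u)\star f(v))=1$, and $f_\eta^*(uv)=0$ otherwise, satisfies $|e_{f_\eta^*}(0)-e_{f_\eta^*}(1)|\leq 1$, where $e_{f_\eta^*}(i)$ is the number of edges with label $i$. The labeling is called perfect, positive, or negative if $e_{f_\eta^*}(0)-e_{f_\eta^*}(1)$ equals $0$, $1$, or $-1$, respectively. A graph is a (perfect, positive, negative) arithmetic cordial graph modulo $\eta$ under $\langle S,\zeta_\eta,\star\rangle$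 if it admits such a labeling. Here $\star$ is integer addition $+$. Corona graph: for $G$ of order $n$, $G\circ H$ is obtained from one copy of $G$ and $n$ copies of $H$ by making every vertex of the $i$th copy of $H$ adjacent to the $i$th vertex of $G$. *)

theory Defs
  imports "HOL-Number_Theory.Number_Theory" "HOL-Library.FuncSet"
begin

section \<open>Finite simple graphs and coronas\<close>

record 'v ugraph =
  verts :: "'v set"
  edges :: "'v set set"

definition simple_graph :: "'v ugraph \<Rightarrow> bool" where
  "simple_graph G \<longleftrightarrow> finite (verts G) \<and> (\<forall>e\<in>edges G. e \<subseteq> verts G \<and> card e = 2)"

definition graph_order :: "'v ugraph \<Rightarrow> nat" where
  "graph_order G = card (verts G)"

text \<open>The copies of \<open>H\<close> are indexed by the vertices of \<open>G\<close> themselves: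
  \<open>Inl x\<close> is the vertex \<open>x\<close> of \<open>G\<close>, and \<open>Inr (x, y)\<close> is the vertex \<open>y\<close> in the copy of \<open>H\<close>
  attached to \<open>x\<close>.\<close>

definition corona :: "'a ugraph \<Rightarrow> 'b ugraph \<Rightarrow> ('a + 'a \<times> 'b) ugraph" where
  "corona G H =
     \<lparr> verts = Inl ` verts G \<union> Inr ` (verts G \<times> verts H),
       edges = {Inl ` e | e. e \<in> edges G}
             \<union> {(\<lambda>y. Inr (x, y)) ` e | x e. x \<in> verts G \<and> e \<in> edges H}
             \<union> {{Inl x, Inr (x, y)} | x y. x \<in> verts G \<and> y \<in> verts H} \<rparr>"

lemma simple_graph_corona:
  assumes "simple_graph G" "simple_graph H"
  shows "simple_graph (corona G H)"
  using assms unfolding simple_graph_def corona_def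
  by (fastforce simp: card_image inj_on_def)

section \<open>Arithmetic cordial labelings\<close>

text \<open>Here \<open>\<zeta>\<close> is a total function, but it is only ever inspected at integers coprime to \<open>\<eta>\<close>.
  The operation \<open>star\<close> is implicitly commutative on the labels, since edges are unordered;
  this makes the choice of \<open>u\<close> and \<open>v\<close> immaterial.\<close>

definition induced_label ::
  "nat \<Rightarrow> (int \<Rightarrow> nat) \<Rightarrow> (int \<Rightarrow> int \<Rightarrow> int) \<Rightarrow> ('v \<Rightarrow> int) \<Rightarrow> 'v set \<Rightarrow> nat" where
  "induced_label \<eta> \<zeta> star f e =
     (if \<exists>u v. e = {u, v} \<and> gcd (star (f u) (f v)) (int \<eta>) = 1 \<and> \<zeta> (star (f u) (f v)) = 1
      then 1 else 0)"

lemma induced_label_edge: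
  assumes "star (f u) (f v) = star (f v) (f u)"
  shows "induced_label \<eta> \<zeta> star f {u, v} =
    (if gcd (star (f u) (f v)) (int \<eta>) = 1 \<and> \<zeta> (star (f u) (f v)) = 1 then 1 else 0)"
proof -
  have "(\<exists>a b. {u, v} = {a, b} \<and> P (star (f a) (f b))) \<longleftrightarrow> P (star (f u) (f v))" for P
    using assms by (metis doubleton_eq_iff)
  from this[of "\<lambda>s. gcd s (int \<eta>) = 1 \<and> \<zeta> s = 1"] show ?thesis
    unfolding induced_label_def by simp
qed

definition edge_count ::
  "nat \<Rightarrow> (int \<Rightarrow> nat) \<Rightarrow> (int \<Rightarrow> int \<Rightarrow> int) \<Rightarrow> 'v ugraph \<Rightarrow> ('v \<Rightarrow> int) \<Rightarrow> nat \<Rightarrow> nat" where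
  "edge_count \<eta> \<zeta> star G f i = card {e \<in> edges G. induced_label \<eta> \<zeta> star f e = i}"

definition label_excess ::
  "nat \<Rightarrow> (int \<Rightarrow> nat) \<Rightarrow> (int \<Rightarrow> int \<Rightarrow> int) \<Rightarrow> 'v ugraph \<Rightarrow> ('v \<Rightarrow> int) \<Rightarrow> int" where
  "label_excess \<eta> \<zeta> star G f =
     int (edge_count \<eta> \<zeta> star G f 0) - int (edge_count \<eta> \<zeta> star G f 1)"

definition arithmetic_cordial_labeling ::
  "nat \<Rightarrow> int set \<Rightarrow> (int \<Rightarrow> nat) \<Rightarrow> (int \<Rightarrow> int \<Rightarrow> int) \<Rightarrow> 'v ugraph \<Rightarrow> ('v \<Rightarrow> int) \<Rightarrow> bool" where
  "arithmetic_cordial_labeling \<eta> S \<zeta> star G f \<longleftrightarrow>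
     bij_betw f (verts G) S \<and> \<bar>label_excess \<eta> \<zeta> star G f\<bar> \<le> 1"

definition arithmetic_cordial_graph ::
  "nat \<Rightarrow> int set \<Rightarrow> (int \<Rightarrow> nat) \<Rightarrow> (int \<Rightarrow> int \<Rightarrow> int) \<Rightarrow> 'v ugraph \<Rightarrow> bool" where
  "arithmetic_cordial_graph \<eta> S \<zeta> star G \<longleftrightarrow>
     (\<exists>f. arithmetic_cordial_labeling \<eta> S \<zeta> star G f)"

definition perfect_arithmetic_cordial_graph ::
  "nat \<Rightarrow> int set \<Rightarrow> (int \<Rightarrow> nat) \<Rightarrow> (int \<Rightarrow> int \<Rightarrow> int) \<Rightarrow> 'v ugraph \<Rightarrow> bool" where
  "perfect_arithmetic_cordial_graph \<eta> S \<zeta> star G \<longleftrightarrow>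
     (\<exists>f. arithmetic_cordial_labeling \<eta> S \<zeta> star G f \<and> label_excess \<eta> \<zeta> star G f = 0)"

definition positive_arithmetic_cordial_graph ::
  "nat \<Rightarrow> int set \<Rightarrow> (int \<Rightarrow> nat) \<Rightarrow> (int \<Rightarrow> int \<Rightarrow> int) \<Rightarrow> 'v ugraph \<Rightarrow> bool" where
  "positive_arithmetic_cordial_graph \<eta> S \<zeta> star G \<longleftrightarrow>
     (\<exists>f. arithmetic_cordial_labeling \<eta> S \<zeta> star G f \<and> label_excess \<eta> \<zeta> star G f = 1)"

definition negative_arithmetic_cordial_graph ::
  "nat \<Rightarrow> int set \<Rightarrow> (int \<Rightarrow> nat) \<Rightarrow> (int \<Rightarrow> int \<Rightarrow> int) \<Rightarrow> 'v ugraph \<Rightarrow> bool" where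
  "negative_arithmetic_cordial_graph \<eta> S \<zeta> star G \<longleftrightarrow>
     (\<exists>f. arithmetic_cordial_labeling \<eta> S \<zeta> star G f \<and> label_excess \<eta> \<zeta> star G f = -1)"

section \<open>The quantity \<open>\<varpi>\<close>\<close>

definition zeta_residues :: "nat \<Rightarrow> (int \<Rightarrow> nat) \<Rightarrow> nat \<Rightarrow> int set" where
  "zeta_residues \<eta> \<zeta> j = {a. 0 < a \<and> a < int \<eta> \<and> gcd a (int \<eta>) = 1 \<and> \<zeta> a = j}"

definition Gamma1 :: "nat \<Rightarrow> (int \<Rightarrow> nat) \<Rightarrow> 'v ugraph \<Rightarrow> ('v \<Rightarrow> int) \<Rightarrow> 'v set set" where
  "Gamma1 \<eta> \<zeta> G g =
     {{u, v} | u v. {u, v} \<in> edges G \<and> gcd (g u + g v) (int \<eta>) = 1 \<and> \<zeta> (g u + g v) = 1}"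

definition Gamma0 :: "nat \<Rightarrow> (int \<Rightarrow> nat) \<Rightarrow> 'v ugraph \<Rightarrow> ('v \<Rightarrow> int) \<Rightarrow> 'v set set" where
  "Gamma0 \<eta> \<zeta> G g =
     {{u, v} | u v. {u, v} \<in> edges G \<and> gcd (g u + g v) (int \<eta>) \<noteq> 1}
   \<union> {{u, v} | u v. {u, v} \<in> edges G \<and> gcd (g u + g v) (int \<eta>) = 1 \<and> \<zeta> (g u + g v) = 0}"

definition varpi ::
  "nat \<Rightarrow> (int \<Rightarrow> nat) \<Rightarrow> nat \<Rightarrow> nat \<Rightarrow> 'a ugraph \<Rightarrow> 'b ugraph \<Rightarrow> ('a \<Rightarrow> int) \<Rightarrow> ('b \<Rightarrow> int) \<Rightarrow> int" where
  "varpi \<eta> \<zeta> n k G H g h =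
     int n * int k * (int \<eta> - int (totient \<eta>)
        + int (card (zeta_residues \<eta> \<zeta> 0)) - int (card (zeta_residues \<eta> \<zeta> 1)))
   + int n * (int (card (Gamma0 \<eta> \<zeta> H h)) - int (card (Gamma1 \<eta> \<zeta> H h)))
   + int (card (Gamma0 \<eta> \<zeta> G g)) - int (card (Gamma1 \<eta> \<zeta> G g))"

end

theory Submission
  imports Defs
begin

text \<open>
  Give the vertices of the copies of \<open>H\<close> the small labels and the vertices of \<open>G\<close> the large ones:
  with \<open>M = k * \<eta>\<close>, the vertex \<open>y\<close> in the copy attached to \<open>x\<close> gets \<open>(g x - 1) * M + h y\<close>, and \<open>x\<close>
  itself gets \<open>n * M + g x\<close>.  The copies fill the consecutive blocks of length \<open>M\<close> in \<open>{1..n * M}\<close>,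
  and \<open>G\<close> fills the \<open>n\<close> labels that remain.  The point of this order is that every shift is a
  multiple of \<open>\<eta>\<close>, so modulo \<open>\<eta>\<close> the labels are just \<open>h y\<close> and \<open>g x\<close>; by the hypothesis on \<open>\<zeta>\<close>,
  the label of an edge depends only on the sum of its end labels modulo \<open>\<eta>\<close>.

  Encode edge labels \<open>0\<close> and \<open>1\<close> by signs \<open>1\<close> and \<open>-1\<close>, so that the excess of zeros over ones is
  the sum of the signs over all edges, and split this sum over the three kinds of edges of the corona
  (\<open>label_excess_corona\<close>).  The edges of \<open>G\<close> contribute the excess of \<open>g\<close>, each of the \<open>n\<close> copies of
  \<open>H\<close> the excess of \<open>h\<close>, and these excesses are the differences of the \<open>\<Gamma>\<close> cardinalities.  For the
  edges from a vertex \<open>x\<close> of \<open>G\<close> to its copy, \<open>g x + h y\<close> runs through \<open>k\<close> complete residue systems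
  modulo \<open>\<eta>\<close>, so \<open>x\<close> contributes \<open>k\<close> times the sum of the signs over one system
  (\<open>sum_periodic_blocks\<close>), which is \<open>\<eta> - \<phi>(\<eta>) + |A\<^sub>0| - |A\<^sub>1|\<close> (\<open>sum_residue_sign\<close>).
  Altogether the excess is exactly \<open>\<varpi>\<close>, which gives all four claims at once.
\<close>

section \<open>Edge labels as signs\<close>

definition residue_sign :: "nat \<Rightarrow> (int \<Rightarrow> nat) \<Rightarrow> int \<Rightarrow> int" where
  "residue_sign \<eta> \<zeta> s = (if gcd s (int \<eta>) = 1 \<and> \<zeta> s = 1 then -1 else 1)"

definition edge_sign :: "nat \<Rightarrow> (int \<Rightarrow> nat) \<Rightarrow> ('v \<Rightarrow> int) \<Rightarrow> 'v set \<Rightarrow> int" where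
  "edge_sign \<eta> \<zeta> f e = 1 - 2 * int (induced_label \<eta> \<zeta> (+) f e)"

lemma edge_sign_pair: "edge_sign \<eta> \<zeta> f {u, v} = residue_sign \<eta> \<zeta> (f u + f v)"
  by (simp add: edge_sign_def residue_sign_def induced_label_edge add.commute)

lemma edge_sign_image:
  assumes "card e = 2"
  shows "edge_sign \<eta> \<zeta> f (\<iota> ` e) = edge_sign \<eta> \<zeta> (f \<circ> \<iota>) e"
proof -
  obtain u v where "e = {u, v}" using assms by (auto simp: card_2_iff)
  then show ?thesis by (simp add: edge_sign_pair)
qed

lemma simple_graph_edge_card: "simple_graph G \<Longrightarrow> e \<in> edges G \<Longrightarrow> card e = 2"
  by (simp add: simple_graph_def)

lemma simple_graph_finite_edges: "simple_graph G \<Longrightarrow> finite (edges G)"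
  unfolding simple_graph_def by (rule finite_subset[of _ "Pow (verts G)"]) auto

lemma label_excess_eq_sum_edge_sign:
  assumes "finite (edges G)"
  shows "label_excess \<eta> \<zeta> (+) G f = (\<Sum>e\<in>edges G. edge_sign \<eta> \<zeta> f e)"
proof -
  let ?l = "induced_label \<eta> \<zeta> (+) f"
  have "edge_sign \<eta> \<zeta> f e = (if ?l e = 0 then 1 else 0) - (if ?l e = 1 then 1 else 0)" for e
    by (simp add: edge_sign_def induced_label_def)
  then have "(\<Sum>e\<in>edges G. edge_sign \<eta> \<zeta> f e)
      = (\<Sum>e\<in>edges G. if ?l e = 0 then 1 else 0) - (\<Sum>e\<in>edges G. if ?l e = 1 then 1 else 0)"
    by (simp add: sum_subtractf)
  also have "\<dots> = label_excess \<eta> \<zeta> (+) G f"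
    using assms by (simp add: label_excess_def edge_count_def sum.If_cases Int_def)
  finally show ?thesis by simp
qed

section \<open>Dependence on residues only\<close>

definition factors_through_residues :: "nat \<Rightarrow> (int \<Rightarrow> nat) \<Rightarrow> bool" where
  "factors_through_residues \<eta> \<zeta> \<longleftrightarrow>
     (\<forall>a b. gcd a (int \<eta>) = 1 \<longrightarrow> gcd b (int \<eta>) = 1 \<longrightarrow> [a = b] (mod int \<eta>) \<longrightarrow> \<zeta> a = \<zeta> b)"

lemma residue_sign_cong:
  assumes per: "factors_through_residues \<eta> \<zeta>"
    and "[s = t] (mod int \<eta>)"
  shows "residue_sign \<eta> \<zeta> s = residue_sign \<eta> \<zeta> t"
proof -
  have "gcd s (int \<eta>) = gcd t (int \<eta>)"
    using assms(2) by (rule cong_gcd_eq)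
  then show ?thesis
    using per assms(2) unfolding factors_through_residues_def residue_sign_def by metis
qed

lemma label_excess_cong:
  assumes per: "factors_through_residues \<eta> \<zeta>"
    and G: "simple_graph G"
    and f: "\<And>v. v \<in> verts G \<Longrightarrow> [f v = f' v] (mod int \<eta>)"
  shows "label_excess \<eta> \<zeta> (+) G f = label_excess \<eta> \<zeta> (+) G f'"
proof -
  have "edge_sign \<eta> \<zeta> f e = edge_sign \<eta> \<zeta> f' e" if e: "e \<in> edges G" for e
  proof -
    obtain u v where uv: "e = {u, v}"
      using simple_graph_edge_card[OF G e] by (auto simp: card_2_iff)
    with G e have "u \<in> verts G" "v \<in> verts G"
      by (auto simp: simple_graph_def)
    then have "[f u + f v = f' u + f' v] (mod int \<eta>)"
      using f by (simp add: cong_add)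
    then show ?thesis
      unfolding uv edge_sign_pair by (rule residue_sign_cong[OF per])
  qed
  then show ?thesis
    by (simp add: label_excess_eq_sum_edge_sign simple_graph_finite_edges G)
qed

section \<open>The edges counted by the quantity \<open>\<varpi>\<close>\<close>

lemma Gamma1_eq_edges_labelled_1:
  "Gamma1 \<eta> \<zeta> G g = {e \<in> edges G. induced_label \<eta> \<zeta> (+) g e = 1}" (is "?L = ?R")
proof
  show "?L \<subseteq> ?R"
    by (auto simp: Gamma1_def induced_label_edge add.commute)
next
  show "?R \<subseteq> ?L"
  proof
    fix e assume "e \<in> ?R"
    then have "e \<in> edges G" and "induced_label \<eta> \<zeta> (+) g e \<noteq> 0"
      by auto
    then show "e \<in> ?L"
      unfolding Gamma1_def induced_label_def by (smt (verit) mem_Collect_eq)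
  qed
qed

text \<open>Every edge not labelled \<open>1\<close> is caught by one of the two parts of \<open>\<Gamma>\<^sub>0\<close>, because \<open>\<zeta>\<close> takes no value
  besides \<open>0\<close> and \<open>1\<close> at integers coprime to \<open>\<eta>\<close>.\<close>

lemma Gamma0_eq_edges_labelled_0:
  assumes \<zeta>: "\<zeta> \<in> {\<xi>. gcd \<xi> (int \<eta>) = 1} \<rightarrow> {0, 1}" and G: "simple_graph G"
  shows "Gamma0 \<eta> \<zeta> G g = {e \<in> edges G. induced_label \<eta> \<zeta> (+) g e = 0}" (is "?L = ?R")
proof
  show "?L \<subseteq> ?R"
    by (auto simp: Gamma0_def induced_label_edge add.commute)
next
  show "?R \<subseteq> ?L"
  proof
    fix e assume e: "e \<in> ?R"
    then obtain u v where uv: "e = {u, v}"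
      using simple_graph_edge_card[OF G] by (fastforce simp: card_2_iff)
    have "\<not> (gcd (g u + g v) (int \<eta>) = 1 \<and> \<zeta> (g u + g v) = 1)"
      using e by (auto simp: uv induced_label_edge add.commute split: if_splits)
    then have "gcd (g u + g v) (int \<eta>) \<noteq> 1 \<or> gcd (g u + g v) (int \<eta>) = 1 \<and> \<zeta> (g u + g v) = 0"
      using \<zeta> by auto
    then show "e \<in> ?L"
      using e unfolding uv Gamma0_def by blast
  qed
qed

lemma label_excess_eq_card_Gamma:
  assumes "\<zeta> \<in> {\<xi>. gcd \<xi> (int \<eta>) = 1} \<rightarrow> {0, 1}" and "simple_graph G"
  shows "label_excess \<eta> \<zeta> (+) G g = int (card (Gamma0 \<eta> \<zeta> G g)) - int (card (Gamma1 \<eta> \<zeta> G g))"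
  using assms
  by (simp add: label_excess_def edge_count_def Gamma0_eq_edges_labelled_0 Gamma1_eq_edges_labelled_1)

section \<open>Sums over complete residue systems\<close>

text \<open>Reduction modulo \<open>m\<close> maps any \<open>m\<close> consecutive integers bijectively onto \<open>{0..<m}\<close>.\<close>

lemma sum_periodic_block:
  fixes p :: "int \<Rightarrow> int" and m :: nat
  assumes per: "\<And>s. p (s mod int m) = p s"
  shows "(\<Sum>s\<in>{c<..c + int m}. p s) = (\<Sum>a\<in>{0..<int m}. p a)"
proof (cases "m = 0")
  case False
  have inj: "inj_on (\<lambda>s. s mod int m) {c<..c + int m}"
  proof (rule inj_onI)
    fix s t assume st: "s \<in> {c<..c + int m}" "t \<in> {c<..c + int m}" "s mod int m = t mod int m"
    then have dvd: "int m dvd s - t"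
      by (simp add: mod_eq_dvd_iff)
    have less: "\<bar>s - t\<bar> < int m"
      using st by auto
    show "s = t"
    proof (rule ccontr)
      assume "s \<noteq> t"
      then have "\<bar>int m\<bar> \<le> \<bar>s - t\<bar>"
        using dvd by (intro dvd_imp_le_int) auto
      with less show False by simp
    qed
  qed
  moreover have "(\<lambda>s. s mod int m) ` {c<..c + int m} = {0..<int m}"
    by (rule card_subset_eq) (use False in \<open>auto simp: card_image[OF inj]\<close>)
  ultimately have "bij_betw (\<lambda>s. s mod int m) {c<..c + int m} {0..<int m}"
    by (simp add: bij_betw_def)
  then have "(\<Sum>a\<in>{0..<int m}. p a) = (\<Sum>s\<in>{c<..c + int m}. p (s mod int m))"
    by (rule sum.reindex_bij_betw[symmetric])
  also have "\<dots> = (\<Sum>s\<in>{c<..c + int m}. p s)"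
    by (simp add: per)
  finally show ?thesis by simp
qed simp

lemma sum_periodic_blocks:
  fixes p :: "int \<Rightarrow> int" and m k :: nat
  assumes per: "\<And>s. p (s mod int m) = p s"
  shows "(\<Sum>s\<in>{c<..c + int (k * m)}. p s) = int k * (\<Sum>a\<in>{0..<int m}. p a)"
proof (induction k)
  case (Suc k)
  let ?d = "c + int (k * m)"
  have "c + int (Suc k * m) = ?d + int m"
    by simp
  moreover have "{c<..?d + int m} = {c<..?d} \<union> {?d<..?d + int m}"
    by (rule ivl_disj_un_two(6)[symmetric]) (simp_all del: of_nat_mult)
  moreover have "{c<..?d} \<inter> {?d<..?d + int m} = {}"
    by auto
  ultimately have "(\<Sum>s\<in>{c<..c + int (Suc k * m)}. p s)
      = (\<Sum>s\<in>{c<..?d}. p s) + (\<Sum>s\<in>{?d<..?d + int m}. p s)"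
    by (simp only: sum.union_disjoint[OF finite_greaterThanAtMost_int finite_greaterThanAtMost_int])
  with Suc.IH sum_periodic_block[where p = p and c = ?d, OF per] show ?case
    by (simp add: algebra_simps)
qed simp

lemma card_coprime_residues:
  assumes "\<eta> \<ge> 2"
  shows "card {a. 0 < a \<and> a < int \<eta> \<and> gcd a (int \<eta>) = 1} = totient \<eta>"
proof -
  have "{a. 0 < a \<and> a < int \<eta> \<and> gcd a (int \<eta>) = 1} = int ` totatives \<eta>" (is "?A = ?B")
  proof
    show "?A \<subseteq> ?B"
    proof
      fix a assume a: "a \<in> ?A"
      then have "a = int (nat a)" by simp
      moreover have "nat a \<in> totatives \<eta>"
      proof -
        have "coprime (int (nat a)) (int \<eta>)"
          using a by (simp add: coprime_iff_gcd_eq_1)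
        then have "coprime (nat a) \<eta>"
          by (simp only: coprime_int_iff)
        with a show ?thesis
          by (auto simp: in_totatives_iff)
      qed
      ultimately show "a \<in> ?B" by blast
    qed
    show "?B \<subseteq> ?A"
    proof
      fix a assume "a \<in> ?B"
      then obtain b where b: "b \<in> totatives \<eta>" "a = int b" by blast
      then have "0 < b" "coprime b \<eta>" "b < \<eta>"
        using totatives_less[of b \<eta>] assms by (auto simp: in_totatives_iff)
      moreover from this have "gcd (int b) (int \<eta>) = 1"
        by (simp only: coprime_int_iff flip: coprime_iff_gcd_eq_1)
      ultimately show "a \<in> ?A"
        using b by simp
    qed
  qed
  then show ?thesis
    by (simp add: card_image totient_def)
qed

text \<open>The signs add up to \<open>\<eta> - 2 |A\<^sub>1|\<close>, and \<open>A\<^sub>0\<close> and \<open>A\<^sub>1\<close> partition the \<open>\<phi>(\<eta>)\<close> residues coprime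
  to \<open>\<eta>\<close>.  The residue \<open>0\<close> lies in neither set because \<open>\<eta> \<ge> 2\<close> makes it non-coprime.\<close>

lemma sum_residue_sign:
  assumes \<eta>: "\<eta> \<ge> 2" and \<zeta>: "\<zeta> \<in> {\<xi>. gcd \<xi> (int \<eta>) = 1} \<rightarrow> {0, 1}"
  shows "(\<Sum>a\<in>{0..<int \<eta>}. residue_sign \<eta> \<zeta> a)
    = int \<eta> - int (totient \<eta>) + int (card (zeta_residues \<eta> \<zeta> 0)) - int (card (zeta_residues \<eta> \<zeta> 1))"
proof -
  have fin: "finite (zeta_residues \<eta> \<zeta> j)" for j
    by (rule finite_subset[of _ "{0..<int \<eta>}"]) (auto simp: zeta_residues_def)
  have "{a. 0 < a \<and> a < int \<eta> \<and> gcd a (int \<eta>) = 1} = zeta_residues \<eta> \<zeta> 0 \<union> zeta_residues \<eta> \<zeta> 1"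
    using \<zeta> by (auto simp: zeta_residues_def)
  moreover have "zeta_residues \<eta> \<zeta> 0 \<inter> zeta_residues \<eta> \<zeta> 1 = {}"
    by (auto simp: zeta_residues_def)
  ultimately have tot: "totient \<eta> = card (zeta_residues \<eta> \<zeta> 0) + card (zeta_residues \<eta> \<zeta> 1)"
    using card_coprime_residues[OF \<eta>] fin by (simp add: card_Un_disjoint)
  have "residue_sign \<eta> \<zeta> a = 1 - 2 * (if a \<in> zeta_residues \<eta> \<zeta> 1 then 1 else 0)"
    if "a \<in> {0..<int \<eta>}" for a
    using that \<eta> by (cases "a = 0") (auto simp: residue_sign_def zeta_residues_def)
  then have "(\<Sum>a\<in>{0..<int \<eta>}. residue_sign \<eta> \<zeta> a)
      = (\<Sum>a\<in>{0..<int \<eta>}. 1 - 2 * (if a \<in> zeta_residues \<eta> \<zeta> 1 then 1 else 0))"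
    by (rule sum.cong[OF refl])
  also have "\<dots> = int \<eta> - 2 * int (card ({0..<int \<eta>} \<inter> zeta_residues \<eta> \<zeta> 1))"
    by (simp add: sum_subtractf sum.If_cases flip: sum_distrib_left)
  also have "{0..<int \<eta>} \<inter> zeta_residues \<eta> \<zeta> 1 = zeta_residues \<eta> \<zeta> 1"
    by (auto simp: zeta_residues_def)
  finally show ?thesis
    by (simp add: tot)
qed

section \<open>Labellings of coronas\<close>

lemma label_excess_corona:
  assumes G: "simple_graph G" and H: "simple_graph H"
  shows "label_excess \<eta> \<zeta> (+) (corona G H) f
    = label_excess \<eta> \<zeta> (+) G (\<lambda>x. f (Inl x))
      + (\<Sum>x\<in>verts G. label_excess \<eta> \<zeta> (+) H (\<lambda>y. f (Inr (x, y))))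
      + (\<Sum>x\<in>verts G. \<Sum>y\<in>verts H. residue_sign \<eta> \<zeta> (f (Inl x) + f (Inr (x, y))))"
proof -
  let ?s = "edge_sign \<eta> \<zeta>"
  define A :: "('a + 'a \<times> 'b) set set" where "A = (`) Inl ` edges G"
  define B :: "('a + 'a \<times> 'b) set set"
    where "B = (\<lambda>(x, e). (\<lambda>y. Inr (x, y)) ` e) ` (verts G \<times> edges H)"
  define C :: "('a + 'a \<times> 'b) set set"
    where "C = (\<lambda>(x, y). {Inl x, Inr (x, y)}) ` (verts G \<times> verts H)"
  have fin: "finite (verts G)" "finite (verts H)" "finite (edges G)" "finite (edges H)"
    using G H simple_graph_finite_edges by (auto simp: simple_graph_def)
  have edges: "edges (corona G H) = A \<union> B \<union> C"
    by (auto simp: corona_def A_def B_def C_def)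
  have ne: "e \<noteq> {}" if "e \<in> edges H" for e
    using simple_graph_edge_card[OF H that] by auto
  have neG: "e \<noteq> {}" if "e \<in> edges G" for e
    using simple_graph_edge_card[OF G that] by auto
  have "finite A" "finite B" "finite C"
    using fin by (auto simp: A_def B_def C_def)
  moreover have "A \<inter> B = {}" "(A \<union> B) \<inter> C = {}"
    using ne neG by (auto simp: A_def B_def C_def)
  ultimately have "(\<Sum>e\<in>edges (corona G H). ?s f e)
      = (\<Sum>e\<in>A. ?s f e) + (\<Sum>e\<in>B. ?s f e) + (\<Sum>e\<in>C. ?s f e)"
    by (simp add: edges sum.union_disjoint)
  moreover have "(\<Sum>e\<in>A. ?s f e) = label_excess \<eta> \<zeta> (+) G (\<lambda>x. f (Inl x))"
  proof -
    have "inj_on ((`) (Inl :: 'a \<Rightarrow> 'a + 'a \<times> 'b)) (edges G)"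
      by (simp add: inj_on_def inj_image_eq_iff)
    then have "(\<Sum>e\<in>A. ?s f e) = (\<Sum>e\<in>edges G. ?s f (Inl ` e))"
      by (simp add: A_def sum.reindex)
    also have "\<dots> = (\<Sum>e\<in>edges G. ?s (\<lambda>x. f (Inl x)) e)"
      using simple_graph_edge_card[OF G] by (simp add: edge_sign_image comp_def)
    finally show ?thesis
      by (simp add: label_excess_eq_sum_edge_sign fin)
  qed
  moreover have "(\<Sum>e\<in>B. ?s f e) = (\<Sum>x\<in>verts G. label_excess \<eta> \<zeta> (+) H (\<lambda>y. f (Inr (x, y))))"
  proof -
    \<comment> \<open>An edge of a copy of \<open>H\<close> remembers its copy because it is nonempty.\<close>
    have "inj_on (\<lambda>(x, e). (\<lambda>y. Inr (x, y) :: 'a + 'a \<times> 'b) ` e) (verts G \<times> edges H)"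
    proof (rule inj_onI, clarify)
      fix x e x' e'
      assume e: "e \<in> edges H" "e' \<in> edges H"
        and eq: "(\<lambda>y. Inr (x, y) :: 'a + 'a \<times> 'b) ` e = (\<lambda>y. Inr (x', y)) ` e'"
      from ne[OF e(1)] obtain y where "y \<in> e" by blast
      with eq have "x = x'" by blast
      with eq show "x = x' \<and> e = e'"
        by (simp add: inj_image_eq_iff inj_def)
    qed
    then have "(\<Sum>e\<in>B. ?s f e)
        = (\<Sum>(x, e)\<in>verts G \<times> edges H. ?s f ((\<lambda>y. Inr (x, y)) ` e))"
      by (simp add: B_def sum.reindex case_prod_unfold comp_def)
    also have "\<dots> = (\<Sum>x\<in>verts G. \<Sum>e\<in>edges H. ?s (\<lambda>y. f (Inr (x, y))) e)"
      using simple_graph_edge_card[OF H]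
      by (simp add: edge_sign_image comp_def flip: sum.cartesian_product)
    finally show ?thesis
      by (simp add: label_excess_eq_sum_edge_sign fin)
  qed
  moreover have "(\<Sum>e\<in>C. ?s f e)
      = (\<Sum>x\<in>verts G. \<Sum>y\<in>verts H. residue_sign \<eta> \<zeta> (f (Inl x) + f (Inr (x, y))))"
  proof -
    have "inj_on (\<lambda>(x, y). {Inl x, Inr (x, y)} :: ('a + 'a \<times> 'b) set) (verts G \<times> verts H)"
      by (auto simp: inj_on_def doubleton_eq_iff)
    then have "(\<Sum>e\<in>C. ?s f e) = (\<Sum>(x, y)\<in>verts G \<times> verts H. ?s f {Inl x, Inr (x, y)})"
      by (simp add: C_def sum.reindex case_prod_unfold comp_def)
    then show ?thesis
      by (simp add: edge_sign_pair sum.cartesian_product)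
  qed
  moreover have "finite (edges (corona G H))"
    using simple_graph_finite_edges simple_graph_corona G H by blast
  ultimately show ?thesis
    by (simp add: label_excess_eq_sum_edge_sign)
qed

text \<open>The pairs \<open>(i, t)\<close> are the two-digit expansions to base \<open>M\<close>, with digits counted from \<open>1\<close>;
  the leading digit is recovered by subtracting \<open>1\<close> and dividing by \<open>M\<close>.\<close>

lemma bij_betw_block_numbering:
  fixes n M :: nat
  shows "bij_betw (\<lambda>(i, t). (i - 1) * int M + t) ({1..int n} \<times> {1..int M}) {1..int (n * M)}"
proof -
  let ?b = "\<lambda>(i, t). (i - 1) * int M + t" and ?D = "{1..int n} \<times> {1..int M}"
  have inj: "inj_on ?b ?D"
  proof (rule inj_onI, clarify)
    fix i t i' t' :: int
    assume i: "i \<in> {1..int n}" "i' \<in> {1..int n}" and t: "t \<in> {1..int M}" "t' \<in> {1..int M}"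
      and eq: "(i - 1) * int M + t = (i' - 1) * int M + t'"
    have digit: "((j - 1) * int M + s - 1) div int M = j - 1" if "s \<in> {1..int M}" for j s :: int
    proof -
      have "((j - 1) * int M + s - 1) div int M = ((s - 1) + (j - 1) * int M) div int M"
        by (simp add: algebra_simps)
      also have "\<dots> = j - 1"
        using that by (subst div_mult_self1) auto
      finally show ?thesis .
    qed
    have "i = i'"
      using digit[OF t(1), of i] digit[OF t(2), of i'] eq by simp
    with eq show "i = i' \<and> t = t'" by simp
  qed
  moreover have "?b ` ?D = {1..int (n * M)}"
  proof (rule card_subset_eq)
    show "?b ` ?D \<subseteq> {1..int (n * M)}"
    proof clarify
      fix i t :: int assume "i \<in> {1..int n}" "t \<in> {1..int M}"
      moreover from this have "(i - 1) * int M \<le> (int n - 1) * int M" "0 \<le> (i - 1) * int M"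
        by (auto intro: mult_right_mono)
      moreover have "int (n * M) = (int n - 1) * int M + int M"
        by (simp add: algebra_simps)
      ultimately show "(i - 1) * int M + t \<in> {1..int (n * M)}"
        unfolding atLeastAtMost_iff by linarith
    qed
    show "card (?b ` ?D) = card {1..int (n * M)}"
      by (simp add: card_image[OF inj] nat_mult_distrib)
  qed simp
  ultimately show ?thesis
    by (simp add: bij_betw_def)
qed

definition corona_labelling ::
  "nat \<Rightarrow> nat \<Rightarrow> ('a \<Rightarrow> int) \<Rightarrow> ('b \<Rightarrow> int) \<Rightarrow> 'a + 'a \<times> 'b \<Rightarrow> int" where
  "corona_labelling n M g h =
     case_sum (\<lambda>x. int (n * M) + g x) (\<lambda>(x, y). (g x - 1) * int M + h y)"

lemma bij_betw_corona_labelling: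
  assumes g: "bij_betw g (verts G) {1..int n}" and h: "bij_betw h (verts H) {1..int M}"
  shows "bij_betw (corona_labelling n M g h) (verts (corona G H)) {1..int (n * (M + 1))}"
proof -
  let ?f = "corona_labelling n M g h"
  have "bij_betw (\<lambda>i. int (n * M) + i) {1..int n} {int (n * M) + 1..int (n * M) + int n}"
    by (simp add: bij_betw_def)
  from bij_betw_trans[OF g this]
  have "bij_betw (?f \<circ> Inl) (verts G) {int (n * M) + 1..int (n * M) + int n}"
    by (simp add: corona_labelling_def comp_def)
  then have "bij_betw ?f (Inl ` verts G) {int (n * M) + 1..int (n * M) + int n}"
    by (simp add: bij_betw_def inj_on_imageI image_comp)
  moreover have "bij_betw ?f (Inr ` (verts G \<times> verts H)) {1..int (n * M)}"
  proof -
    have "bij_betw (map_prod g h) (verts G \<times> verts H) ({1..int n} \<times> {1..int M})"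
      using g h by (rule bij_betw_map_prod)
    from bij_betw_trans[OF this bij_betw_block_numbering]
    have "bij_betw (?f \<circ> Inr) (verts G \<times> verts H) {1..int (n * M)}"
      by (simp add: corona_labelling_def comp_def case_prod_unfold)
    then show ?thesis
      by (simp add: bij_betw_def inj_on_imageI image_comp)
  qed
  ultimately have "bij_betw ?f (Inl ` verts G \<union> Inr ` (verts G \<times> verts H))
      ({int (n * M) + 1..int (n * M) + int n} \<union> {1..int (n * M)})"
    by (rule bij_betw_combine) auto
  moreover have "{int (n * M) + 1..int (n * M) + int n} \<union> {1..int (n * M)} = {1..int (n * (M + 1))}"
  proof -
    have "int (n * (M + 1)) = int (n * M) + int n"
      by simp
    moreover have "0 \<le> int (n * M)"
      by (rule of_nat_0_le_iff)
    ultimately show ?thesis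
      by (auto simp del: of_nat_mult)
  qed
  ultimately show ?thesis
    by (simp add: corona_def)
qed

text \<open>Both shifts in the labelling are multiples of \<open>M = k * \<eta>\<close> and so vanish modulo \<open>\<eta>\<close>, which turns
  each of the three sums for the corona into a term of \<open>\<varpi>\<close>.  In the third one, adding \<open>g x\<close> only
  permutes the residues of the labels \<open>h y\<close>, so every \<open>x\<close> contributes the same amount.\<close>

lemma label_excess_corona_labelling:
  assumes \<eta>: "\<eta> \<ge> 2" and \<zeta>: "\<zeta> \<in> {\<xi>. gcd \<xi> (int \<eta>) = 1} \<rightarrow> {0, 1}"
    and per: "factors_through_residues \<eta> \<zeta>"
    and G: "simple_graph G" and n: "graph_order G = n" and H: "simple_graph H"
    and h: "bij_betw h (verts H) {1..int (k * \<eta>)}"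
  shows "label_excess \<eta> \<zeta> (+) (corona G H) (corona_labelling n (k * \<eta>) g h) = varpi \<eta> \<zeta> n k G H g h"
proof -
  let ?f = "corona_labelling n (k * \<eta>) g h"
  let ?R = "\<Sum>a\<in>{0..<int \<eta>}. residue_sign \<eta> \<zeta> a"
  have fG: "[?f (Inl x) = g x] (mod int \<eta>)" for x
    by (simp add: corona_labelling_def cong_iff_dvd_diff)
  have fH: "[?f (Inr (x, y)) = h y] (mod int \<eta>)" for x y
    by (simp add: corona_labelling_def cong_iff_dvd_diff)
  have spokes: "(\<Sum>y\<in>verts H. residue_sign \<eta> \<zeta> (?f (Inl x) + ?f (Inr (x, y)))) = int k * ?R" for x
  proof -
    have "(\<Sum>y\<in>verts H. residue_sign \<eta> \<zeta> (?f (Inl x) + ?f (Inr (x, y))))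
        = (\<Sum>y\<in>verts H. residue_sign \<eta> \<zeta> (g x + h y))"
      by (intro sum.cong refl residue_sign_cong[OF per] cong_add fG fH)
    also have "\<dots> = (\<Sum>t\<in>{1..int (k * \<eta>)}. residue_sign \<eta> \<zeta> (g x + t))"
      by (rule sum.reindex_bij_betw[OF h])
    also have "\<dots> = (\<Sum>s\<in>{g x<..g x + int (k * \<eta>)}. residue_sign \<eta> \<zeta> s)"
      by (rule sum.reindex_bij_witness[of _ "\<lambda>s. s - g x" "\<lambda>t. g x + t"]) auto
    also have "\<dots> = int k * ?R"
      by (intro sum_periodic_blocks residue_sign_cong[OF per]) simp
    finally show ?thesis .
  qed
  have "label_excess \<eta> \<zeta> (+) (corona G H) ?f
      = label_excess \<eta> \<zeta> (+) G g + int n * label_excess \<eta> \<zeta> (+) H h + int n * (int k * ?R)"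
    using n label_excess_cong[OF per G fG] label_excess_cong[OF per H fH]
    by (simp add: label_excess_corona[OF G H] spokes graph_order_def)
  also have "\<dots> = varpi \<eta> \<zeta> n k G H g h"
    by (simp add: varpi_def label_excess_eq_card_Gamma[OF \<zeta> G] label_excess_eq_card_Gamma[OF \<zeta> H]
        sum_residue_sign[OF \<eta> \<zeta>])
  finally show ?thesis .
qed

theorem theorem3p1:
  fixes \<eta> k n :: nat
    and \<zeta> :: "int \<Rightarrow> nat"
    and G :: "'a ugraph" and H :: "'b ugraph"
    and g :: "'a \<Rightarrow> int" and h :: "'b \<Rightarrow> int"
    and S :: "int set"
  assumes "\<eta> \<ge> 3" and "k \<ge> 1"
    and "\<zeta> \<in> {\<xi>. gcd \<xi> (int \<eta>) = 1} \<rightarrow> {0, 1}"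
    and "\<And>\<theta>\<^sub>1 \<theta>\<^sub>2. gcd \<theta>\<^sub>1 (int \<eta>) = 1 \<Longrightarrow> gcd \<theta>\<^sub>2 (int \<eta>) = 1 \<Longrightarrow>
           [\<theta>\<^sub>1 = \<theta>\<^sub>2] (mod int \<eta>) \<Longrightarrow> \<zeta> \<theta>\<^sub>1 = \<zeta> \<theta>\<^sub>2"
    and "simple_graph G" and "graph_order G = n"
    and "simple_graph H" and "graph_order H = k * \<eta>"
    and "bij_betw g (verts G) {1..int n}"
    and "bij_betw h (verts H) {1..int (k * \<eta>)}"
    and "S = {1..int (n * (k * \<eta> + 1))}"
  shows "(\<bar>varpi \<eta> \<zeta> n k G H g h\<bar> \<le> 1 \<longrightarrow>
            arithmetic_cordial_graph \<eta> S \<zeta> (+) (corona G H)) \<and>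
         (varpi \<eta> \<zeta> n k G H g h = 0 \<longrightarrow>
            perfect_arithmetic_cordial_graph \<eta> S \<zeta> (+) (corona G H)) \<and>
         (varpi \<eta> \<zeta> n k G H g h = 1 \<longrightarrow>
            positive_arithmetic_cordial_graph \<eta> S \<zeta> (+) (corona G H)) \<and>
         (varpi \<eta> \<zeta> n k G H g h = -1 \<longrightarrow>
            negative_arithmetic_cordial_graph \<eta> S \<zeta> (+) (corona G H))"
proof -
  let ?f = "corona_labelling n (k * \<eta>) g h"
  have "\<eta> \<ge> 2" using \<open>\<eta> \<ge> 3\<close> by simp
  moreover have "factors_through_residues \<eta> \<zeta>"
    unfolding factors_through_residues_def using assms(4) by blast
  ultimately have "label_excess \<eta> \<zeta> (+) (corona G H) ?f = varpi \<eta> \<zeta> n k G H g h"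
    by (rule label_excess_corona_labelling[OF _ assms(3) _ assms(5-7) assms(10)])
  moreover have "bij_betw ?f (verts (corona G H)) S"
    unfolding \<open>S = _\<close> by (rule bij_betw_corona_labelling[OF assms(9,10)])
  ultimately show ?thesis
    unfolding arithmetic_cordial_graph_def perfect_arithmetic_cordial_graph_def
      positive_arithmetic_cordial_graph_def negative_arithmetic_cordial_graph_def
      arithmetic_cordial_labeling_def
    by (intro conjI impI exI[of _ ?f]) simp_all
qed

end
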